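(* Let $M\ge 1$ and let $\mathcal{F}'$ be a simple family of subsets of $X=X_1\uplus\cdots\uplus X_M$ ($|X_i|=m_i$) which is an $M$-dimensional $M$-part Sperner family with parameter $L_{[M]}=1$, i.e. for any two distinct $E,F\in\mathcal{F}'$ there exists $j\in[M]$ such that neither of $E\cap X_j$, $F\cap X_j$ contains the other. Suppose $$\sum_{E\in\mathcal{F}'}\frac{1}{\prod_{i=1}^M\binom{m_i}{|E\cap X_i|}}=1.$$ Then for each $i\in[M]$ the trace $\mathcal{F}'_{X_i}=\{F\cap X_i:F\in\mathcal{F}'\}$ is a union of full levels of $2^{X_i}$, i.e. for every $q$, either every $q$-element subset of $X_i$ belongs to $\mathcal{F}'_{X_i}$ or none does. *)

theory Defs
  imports Complex_Main "HOL-Library.Disjoint_Sets"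
begin

text \<open>
  The ground set is split into the parts \<open>X 1, \<dots>, X M\<close>. A simple family (no repeated members)
  is a set of subsets of the ground set.
\<close>

definition part_partition :: "nat \<Rightarrow> (nat \<Rightarrow> 'a set) \<Rightarrow> 'a set \<Rightarrow> bool" where
  "part_partition M X V \<longleftrightarrow>
     (\<forall>i\<in>{1..M}. finite (X i)) \<and> disjoint_family_on X {1..M} \<and> V = (\<Union>i\<in>{1..M}. X i)"

text \<open>
  \<open>M\<close>-dimensional \<open>M\<close>-part Sperner family with parameter \<open>L\<^bsub>[M]\<^esub> = 1\<close>. Incomparability must
  be witnessed in a single part \<open>X j\<close>; this is stronger than \<open>\<F>\<close> being an antichain.
\<close>

definition full_dim_part_Sperner :: "nat \<Rightarrow> (nat \<Rightarrow> 'a set) \<Rightarrow> 'a set set \<Rightarrow> bool" where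
  "full_dim_part_Sperner M X \<F> \<longleftrightarrow>
     (\<forall>E\<in>\<F>. \<forall>F\<in>\<F>. E \<noteq> F \<longrightarrow>
        (\<exists>j\<in>{1..M}. \<not> E \<inter> X j \<subseteq> F \<inter> X j \<and> \<not> F \<inter> X j \<subseteq> E \<inter> X j))"

definition family_trace :: "'a set set \<Rightarrow> 'a set \<Rightarrow> 'a set set" where
  "family_trace \<F> Y = {F \<inter> Y | F. F \<in> \<F>}"

definition level :: "'a set \<Rightarrow> nat \<Rightarrow> 'a set set" where
  "level Y q = {A. A \<subseteq> Y \<and> card A = q}"

definition union_of_full_levels :: "'a set \<Rightarrow> 'a set set \<Rightarrow> bool" where
  "union_of_full_levels Y \<T> \<longleftrightarrow>
     \<T> \<subseteq> Pow Y \<and> (\<forall>q. (\<forall>A\<in>level Y q. A \<in> \<T>) \<or> (\<forall>A\<in>level Y q. A \<notin> \<T>))"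

end

theory Submission
  imports Defs "HOL-Library.FuncSet" "HOL-Combinatorics.Multiset_Permutations"
begin

text \<open>
  Pick a maximal chain in every \<open>X i\<close>. By the Sperner condition at most one member of the family has
  all its traces on the chosen chains, and the sum in the hypothesis is the probability that a
  uniformly random choice of chains catches a member. Hence, in the case of equality, every choice of
  chains catches exactly one member. Given a member \<open>F\<close> with \<open>a \<in> F \<inter> X i\<close> and \<open>b \<in> X i - F\<close>, take
  chains catching \<open>F\<close> such that the one in \<open>X i\<close> runs through \<open>F \<inter> X i - {a}\<close>, \<open>F \<inter> X i\<close>,
  \<open>F \<inter> X i \<union> {b}\<close>, and replace its middle set by \<open>B = F \<inter> X i - {a} \<union> {b}\<close>. The member caught by the
  new chains must have trace \<open>B\<close> on \<open>X i\<close>, since otherwise it would be a second member caught by the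
  old ones. So each trace is closed under exchanging one element, which connects each level.
\<close>

text \<open>Maximal chains are encoded as orderings; the sets of the chain are the initial segments.\<close>

definition chain_contains :: "'a list \<Rightarrow> 'a set \<Rightarrow> bool" where
  "chain_contains xs A \<longleftrightarrow> set (take (card A) xs) = A"

lemma chain_contains_comparable:
  assumes "chain_contains xs A" "chain_contains xs B"
  shows "A \<subseteq> B \<or> B \<subseteq> A"
  using assms set_take_subset_set_take[of "card A" "card B" xs]
    set_take_subset_set_take[of "card B" "card A" xs]
  unfolding chain_contains_def by (metis nat_le_linear)

lemma chain_contains_append:
  assumes "distinct xs"
  shows "chain_contains (xs @ ys) (set xs)"
  using assms by (simp add: chain_contains_def distinct_card)

lemma orderings_through_eq:
  assumes "finite Y" "A \<subseteq> Y"
  shows "{xs \<in> permutations_of_set Y. chain_contains xs A}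
    = (\<lambda>(us, vs). us @ vs) ` (permutations_of_set A \<times> permutations_of_set (Y - A))"
    (is "?L = ?R")
proof
  show "?L \<subseteq> ?R"
  proof
    fix xs assume xs: "xs \<in> ?L"
    let ?us = "take (card A) xs" and ?vs = "drop (card A) xs"
    have d: "distinct xs" "set xs = Y" and us: "set ?us = A"
      using xs by (auto simp: permutations_of_set_def chain_contains_def)
    have "set ?us \<inter> set ?vs = {}" "set ?us \<union> set ?vs = set xs"
      using d(1) by (metis append_take_drop_id distinct_append, metis append_take_drop_id set_append)
    then have "set ?vs = Y - A"
      using d us by blast
    then have "(?us, ?vs) \<in> permutations_of_set A \<times> permutations_of_set (Y - A)"
      using d us by (auto simp: permutations_of_set_def)
    then show "xs \<in> ?R"
      by (rule rev_image_eqI) simp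
  qed
  show "?R \<subseteq> ?L"
    using assms chain_contains_append by (fastforce simp: permutations_of_set_def)
qed

lemma card_orderings_through:
  assumes "finite Y" "A \<subseteq> Y"
  shows "card {xs \<in> permutations_of_set Y. chain_contains xs A}
    = fact (card A) * fact (card Y - card A)"
proof -
  \<comment> \<open>All orderings of \<open>A\<close> have the same length, so a concatenation
    determines where to cut it.\<close>
  have inj: "inj_on (\<lambda>(us, vs). us @ vs) (permutations_of_set A \<times> permutations_of_set (Y - A))"
    by (auto simp: inj_on_def dest!: length_finite_permutations_of_set)
  show ?thesis
    using assms finite_subset[OF assms(2,1)] unfolding orderings_through_eq[OF assms]
    by (simp add: card_image[OF inj] card_cartesian_product card_Diff_subset)
qed

text \<open>A random maximal chain of the subsets of \<open>Y\<close> passes through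
  \<open>A\<close> with probability one over the binomial coefficient. Scaling by the number of all
  orderings turns each summand of the hypothesis into a count.\<close>

lemma orderings_through_fraction:
  assumes "finite Y" "A \<subseteq> Y"
  shows "real (card {xs \<in> permutations_of_set Y. chain_contains xs A})
    = fact (card Y) / real (card Y choose card A)"
proof -
  have "card A \<le> card Y"
    using assms by (rule card_mono)
  then show ?thesis
    by (simp add: card_orderings_through[OF assms] binomial_fact)
qed

lemma card_PiE_filter:
  assumes "finite I"
  shows "card {f \<in> PiE I S. \<forall>i\<in>I. P i (f i)} = (\<Prod>i\<in>I. card {x \<in> S i. P i x})"
proof -
  have "{f \<in> PiE I S. \<forall>i\<in>I. P i (f i)} = PiE I (\<lambda>i. {x \<in> S i. P i x})"
    by (auto simp: PiE_iff extensional_def)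
  then show ?thesis
    using assms by (simp add: card_PiE)
qed

text \<open>By \<open>unique\<close>, the sets \<open>C E\<close> of chain choices catching
  \<open>E\<close> are pairwise disjoint, and by \<open>sum\<close> their sizes add up to
  \<open>card P\<close>. Hence they cover the finite set \<open>P\<close>, leaving no choice
  uncaught.\<close>

lemma ex_member_on_chains:
  fixes X :: "'i \<Rightarrow> 'a set"
  assumes I: "finite I" and X: "\<And>i. i \<in> I \<Longrightarrow> finite (X i)"
    and fin: "finite \<F>"
    and unique: "\<And>f E F. \<lbrakk>E \<in> \<F>; F \<in> \<F>; \<forall>i\<in>I. chain_contains (f i) (E \<inter> X i);
        \<forall>i\<in>I. chain_contains (f i) (F \<inter> X i)\<rbrakk> \<Longrightarrow> E = F"
    and sum: "(\<Sum>E\<in>\<F>. 1 / (\<Prod>i\<in>I. real (card (X i) choose card (E \<inter> X i)))) = 1"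
    and f: "f \<in> PiE I (\<lambda>i. permutations_of_set (X i))"
  shows "\<exists>E\<in>\<F>. \<forall>i\<in>I. chain_contains (f i) (E \<inter> X i)"
proof -
  define P where "P = PiE I (\<lambda>i. permutations_of_set (X i))"
  define C where "C E = {g \<in> P. \<forall>i\<in>I. chain_contains (g i) (E \<inter> X i)}" for E
  have finP: "finite P"
    unfolding P_def using I by (intro finite_PiE) auto
  have cardP: "real (card P) = (\<Prod>i\<in>I. fact (card (X i)))"
    using I X by (simp add: P_def card_PiE)
  have cardC: "real (card (C E))
      = real (card P) * (1 / (\<Prod>i\<in>I. real (card (X i) choose card (E \<inter> X i))))" for E
  proof -
    have "real (card (C E)) = (\<Prod>i\<in>I. real (card
        {xs \<in> permutations_of_set (X i). chain_contains xs (E \<inter> X i)}))"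
      unfolding C_def P_def by (subst card_PiE_filter[OF I]) simp
    also have "\<dots> = (\<Prod>i\<in>I. fact (card (X i)) / real (card (X i) choose card (E \<inter> X i)))"
      by (intro prod.cong refl orderings_through_fraction X) auto
    finally show ?thesis
      by (simp add: cardP prod_dividef)
  qed
  have "real (card (\<Union>E\<in>\<F>. C E)) = (\<Sum>E\<in>\<F>. real (card (C E)))"
  proof (subst card_UN_disjoint)
    show "\<forall>E\<in>\<F>. finite (C E)"
      using finP by (simp add: C_def)
    show "\<forall>E\<in>\<F>. \<forall>F\<in>\<F>. E \<noteq> F \<longrightarrow> C E \<inter> C F = {}"
      using unique by (auto simp: C_def)
  qed (simp_all add: fin)
  also have "\<dots> = real (card P)"
    unfolding cardC by (simp only: sum_distrib_left[symmetric] sum mult_1_right)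
  finally have "(\<Union>E\<in>\<F>. C E) = P"
    using finP by (intro card_subset_eq) (auto simp: C_def)
  with f have "f \<in> (\<Union>E\<in>\<F>. C E)"
    by (simp add: P_def)
  then show ?thesis
    by (auto simp: C_def)
qed

text \<open>Swapping the neighbours \<open>a\<close> and \<open>b\<close> changes only the initial
  segment of length \<open>card A\<close>. Every other set on the new chain also lies on the old one
  and differs from \<open>A\<close> in size.\<close>

lemma exchange_orderings:
  assumes "finite Y" "A \<subseteq> Y" "a \<in> A" "b \<in> Y - A"
  obtains xs ys where "xs \<in> permutations_of_set Y" "ys \<in> permutations_of_set Y"
    "chain_contains xs A"
    "\<And>C. chain_contains ys C \<Longrightarrow> C = insert b (A - {a}) \<or> chain_contains xs C \<and> C \<noteq> A"
proof -
  have finA: "finite A"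
    using assms finite_subset by blast
  obtain us where us: "set us = A - {a}" "distinct us"
    using finite_distinct_list[of "A - {a}"] finA by auto
  obtain vs where vs: "set vs = Y - A - {b}" "distinct vs"
    using finite_distinct_list[of "Y - A - {b}"] assms by auto
  let ?xs = "us @ a # b # vs" and ?ys = "us @ b # a # vs"
  have len: "card A = Suc (length us)"
    using us finA assms(3) by (metis card_Suc_Diff1 distinct_card)
  show thesis
  proof
    show "?xs \<in> permutations_of_set Y" "?ys \<in> permutations_of_set Y"
      using us vs assms by (auto simp: permutations_of_set_def)
    show "chain_contains ?xs A"
      using us assms by (auto simp: chain_contains_def len)
    fix C assume C: "chain_contains ?ys C"
    show "C = insert b (A - {a}) \<or> chain_contains ?xs C \<and> C \<noteq> A"
    proof (cases "card C = card A")
      case True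
      then show ?thesis
        using C us by (auto simp: chain_contains_def len)
    next
      case False
      \<comment> \<open>A cut elsewhere does not separate \<open>a\<close> from \<open>b\<close>:
        the prefix contains neither or both, so their order is irrelevant.\<close>
      then have "card C \<le> length us \<or> (\<exists>k. card C = Suc (Suc (length us + k)))"
        unfolding len by presburger
      then have "set (take (card C) ?xs) = set (take (card C) ?ys)"
        by auto
      with C False show ?thesis
        by (auto simp: chain_contains_def)
    qed
  qed
qed

text \<open>Distinct finite sets of equal size each have an element outside the other. Exchanging
  such a pair brings \<open>A\<close> one step closer to \<open>B\<close>, so induction on
  \<open>card (A - B)\<close> applies.\<close>

lemma exchange_closed_imp_full_level:
  assumes "finite Y"
    and exchange: "\<And>A a b. \<lbrakk>A \<in> T; A \<subseteq> Y; a \<in> A; b \<in> Y - A\<rbrakk> \<Longrightarrow> insert b (A - {a}) \<in> T"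
    and "A \<in> T" "A \<subseteq> Y" "B \<subseteq> Y" "card A = card B"
  shows "B \<in> T"
  using assms(3,4,6)
proof (induction "card (A - B)" arbitrary: A rule: less_induct)
  case less
  have fin: "finite A" "finite B"
    using less.prems assms finite_subset by blast+
  show ?case
  proof (cases "A = B")
    case False
    have "\<not> A \<subseteq> B" "\<not> B \<subseteq> A"
      using False fin less.prems(3) card_subset_eq[of B A] card_subset_eq[of A B] by auto
    then obtain a b where ab: "a \<in> A" "a \<notin> B" "b \<in> B" "b \<notin> A"
      by blast
    let ?A = "insert b (A - {a})"
    have "?A \<in> T"
      using exchange less.prems ab assms(5) by blast
    moreover have "card ?A = card B"
      using ab fin less.prems(3) by (simp add: card_Suc_Diff1 del: card_Diff_insert)
    moreover have "card (?A - B) < card (A - B)"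
      using ab fin by (intro psubset_card_mono) auto
    ultimately show ?thesis
      using less.hyps[of ?A] less.prems(2) ab assms(5) by auto
  qed (use less.prems in simp)
qed

theorem theorem4p4:
  fixes M :: nat and X :: "nat \<Rightarrow> 'a set" and V :: "'a set"
    and m :: "nat \<Rightarrow> nat" and \<F> :: "'a set set"
  assumes "M \<ge> 1"
    and "part_partition M X V"
    and "\<And>i. i \<in> {1..M} \<Longrightarrow> card (X i) = m i"
    and "\<F> \<subseteq> Pow V"
    and "full_dim_part_Sperner M X \<F>"
    and "(\<Sum>E\<in>\<F>. 1 / (\<Prod>i=1..M. real (m i choose card (E \<inter> X i)))) = 1"
  shows "\<forall>i\<in>{1..M}. union_of_full_levels (X i) (family_trace \<F> (X i))"
proof
  fix i assume i: "i \<in> {1..M}"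
  have finX: "finite (X j)" if "j \<in> {1..M}" for j
    using assms(2) that by (simp add: part_partition_def)
  \<comment> \<open>A sum over an infinite set is 0 by convention, not 1.\<close>
  have "finite \<F>"
    by (rule ccontr) (use assms(6) in simp)
  have unique: "E = F" if mem: "E \<in> \<F>" "F \<in> \<F>"
    and on: "\<forall>j\<in>{1..M}. chain_contains (f j) (E \<inter> X j)" "\<forall>j\<in>{1..M}. chain_contains (f j) (F \<inter> X j)"
    for f E F
  proof (rule ccontr)
    assume "E \<noteq> F"
    then obtain j where "j \<in> {1..M}" "\<not> E \<inter> X j \<subseteq> F \<inter> X j" "\<not> F \<inter> X j \<subseteq> E \<inter> X j"
      using assms(5) mem unfolding full_dim_part_Sperner_def by blast
    with on chain_contains_comparable[of "f j" "E \<inter> X j" "F \<inter> X j"] show False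
      by blast
  qed
  have sum: "(\<Sum>E\<in>\<F>. 1 / (\<Prod>j\<in>{1..M}. real (card (X j) choose card (E \<inter> X j)))) = 1"
    using assms(3,6) by simp
  have caught: "\<exists>E\<in>\<F>. \<forall>j\<in>{1..M}. chain_contains (f j) (E \<inter> X j)"
    if "f \<in> PiE {1..M} (\<lambda>j. permutations_of_set (X j))" for f
  proof (rule ex_member_on_chains[OF _ _ \<open>finite \<F>\<close> _ sum that])
    show "E = F" if "E \<in> \<F>" "F \<in> \<F>" "\<forall>j\<in>{1..M}. chain_contains (f j) (E \<inter> X j)"
      "\<forall>j\<in>{1..M}. chain_contains (f j) (F \<inter> X j)" for f E F
      using that by (rule unique)
  qed (simp_all add: finX)
  let ?T = "family_trace \<F> (X i)"
  have exchange: "insert b (A - {a}) \<in> ?T"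
    if A: "A \<in> ?T" "A \<subseteq> X i" "a \<in> A" "b \<in> X i - A" for A a b
  proof -
    obtain F where F: "F \<in> \<F>" "A = F \<inter> X i"
      using A(1) by (auto simp: family_trace_def)
    obtain xs ys where xy: "xs \<in> permutations_of_set (X i)" "ys \<in> permutations_of_set (X i)"
      "chain_contains xs A"
      "\<And>C. chain_contains ys C \<Longrightarrow> C = insert b (A - {a}) \<or> chain_contains xs C \<and> C \<noteq> A"
      using exchange_orderings[OF finX[OF i] A(2-4)] by metis
    have "\<exists>zs. zs \<in> permutations_of_set (X j) \<and> chain_contains zs (F \<inter> X j)"
      if "j \<in> {1..M}" for j
    proof -
      \<comment> \<open>Existence by counting: a product of factorials is nonzero.\<close>
      have "card {zs \<in> permutations_of_set (X j). chain_contains zs (F \<inter> X j)} \<noteq> 0"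
        by (subst card_orderings_through[OF finX[OF that]]) auto
      then show ?thesis
        by (auto simp: card_eq_0_iff)
    qed
    then obtain f where f: "\<And>j. j \<in> {1..M} \<Longrightarrow> f j \<in> permutations_of_set (X j)"
      "\<And>j. j \<in> {1..M} \<Longrightarrow> chain_contains (f j) (F \<inter> X j)"
      by metis
    define g where "g = restrict (f(i := ys)) {1..M}"
    have "g \<in> PiE {1..M} (\<lambda>j. permutations_of_set (X j))"
      unfolding g_def using f(1) xy(2) by (auto simp: PiE_iff)
    then obtain E where E: "E \<in> \<F>" "\<And>j. j \<in> {1..M} \<Longrightarrow> chain_contains (g j) (E \<inter> X j)"
      using caught by blast
    have "chain_contains ys (E \<inter> X i)"
      using E(2)[OF i] i by (simp add: g_def)
    \<comment> \<open>Otherwise putting \<open>xs\<close> back in place of \<open>ys\<close> gives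
      chains catching both \<open>E\<close> and \<open>F\<close>, whose traces on \<open>X i\<close>
      differ.\<close>
    moreover have "\<not> (chain_contains xs (E \<inter> X i) \<and> E \<inter> X i \<noteq> A)"
    proof
      assume *: "chain_contains xs (E \<inter> X i) \<and> E \<inter> X i \<noteq> A"
      have "chain_contains ((f(i := xs)) j) (E \<inter> X j)" if "j \<in> {1..M}" for j
        using * E(2)[OF that] that by (auto simp: g_def)
      moreover have "chain_contains ((f(i := xs)) j) (F \<inter> X j)" if "j \<in> {1..M}" for j
        using f(2)[OF that] xy(3) F(2) by auto
      ultimately have "E = F"
        using unique[OF E(1) F(1)] by blast
      with * F(2) show False
        by blast
    qed
    ultimately have "E \<inter> X i = insert b (A - {a})"
      using xy(4) by blast
    with E(1) show ?thesis
      by (auto simp: family_trace_def)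
  qed
  have "B \<in> ?T" if "A \<in> ?T" "A \<subseteq> X i" "B \<subseteq> X i" "card A = card B" for A B
    by (rule exchange_closed_imp_full_level[OF finX[OF i] exchange that])
  moreover have "?T \<subseteq> Pow (X i)"
    by (auto simp: family_trace_def)
  ultimately show "union_of_full_levels (X i) ?T"
    unfolding union_of_full_levels_def level_def by (metis (mono_tags, lifting) mem_Collect_eq)
qed

end
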